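(* As formal power series in $y$, \[ \sum_{n\ge 0}D_n(x)y^n = -y+xy+x^2y^2+\frac{1+y -x^2y^2} {(1-xy)(1-xy^2)-xy^3}. \]
   Context: For $n\ge 0$, the $S$-fence $\phi_n$ is the poset on $\{x_1,\dots,x_n\}$ whose order is generated by the cover relations $x_2<x_1$, $x_3<x_2$, $x_2<x_4$, $x_5<x_4$, and, for every $i\ge 3$, $x_{2i-1}<x_{2i}$ and $x_{2i+1}<x_{2i}$, keeping only those relations whose elements both have index $\le n$ ($\phi_0$ is empty and $\Phi_0$ is a single vertex). A filter is an up-set. $\Phi_n$ is the underlying undirected graph of the Hasse diagram of the lattice of filters of $\phi_n$ ordered by reverse inclusion (two filters adjacent iff they differ in exactly one element). $d_{n,k}$ is the number of vertices of $\Phi_n$ of degree $k$, and $D_n(x)=\sum_{k\ge0}d_{n,k}x^k$. *)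

theory Defs
  imports "HOL-Computational_Algebra.Computational_Algebra"
begin

(* The element x_i of the fence is represented by its index i, and (a, b) stands for x_a < x_b. *)

definition S_fence_elems :: "nat \<Rightarrow> nat set" where
  "S_fence_elems n = {1..n}"

definition S_fence_covers :: "nat \<Rightarrow> (nat \<times> nat) set" where
  "S_fence_covers n =
     ({(2, 1), (3, 2), (2, 4), (5, 4)} \<union> (\<Union>i\<in>{3..}. {(2 * i - 1, 2 * i), (2 * i + 1, 2 * i)}))
     \<inter> S_fence_elems n \<times> S_fence_elems n"

definition S_fence_le :: "nat \<Rightarrow> nat \<Rightarrow> nat \<Rightarrow> bool" where
  "S_fence_le n a b \<longleftrightarrow>
     a \<in> S_fence_elems n \<and> b \<in> S_fence_elems n \<and> (a, b) \<in> (S_fence_covers n)\<^sup>*"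

definition S_fence_filters :: "nat \<Rightarrow> nat set set" where
  "S_fence_filters n =
     {F. F \<subseteq> S_fence_elems n \<and> (\<forall>a\<in>F. \<forall>b. S_fence_le n a b \<longrightarrow> b \<in> F)}"

(* Reverse inclusion: F lies below G iff G is a subset of F. *)

definition filter_covered_by :: "nat \<Rightarrow> nat set \<Rightarrow> nat set \<Rightarrow> bool" where
  "filter_covered_by n F G \<longleftrightarrow>
     F \<in> S_fence_filters n \<and> G \<in> S_fence_filters n \<and> G \<subset> F \<and>
     \<not> (\<exists>H\<in>S_fence_filters n. G \<subset> H \<and> H \<subset> F)"

(* Phi_n has vertex set S_fence_filters n and edge set Phi_edges n. *)

definition Phi_edges :: "nat \<Rightarrow> nat set set set" where
  "Phi_edges n = {{F, G} | F G. filter_covered_by n F G}"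

definition Phi_degree :: "nat \<Rightarrow> nat set \<Rightarrow> nat" where
  "Phi_degree n F = card {e \<in> Phi_edges n. F \<in> e}"

definition degree_count :: "nat \<Rightarrow> nat \<Rightarrow> nat" where
  "degree_count n k = card {F \<in> S_fence_filters n. Phi_degree n F = k}"

(* The sum over all k is finite: a degree in Phi_n is smaller than the number of vertices
   (see coeff_degree_poly below). *)

definition degree_poly :: "nat \<Rightarrow> int poly" where
  "degree_poly n = (\<Sum>k < card (S_fence_filters n). monom (int (degree_count n k)) k)"

lemma finite_S_fence_filters: "finite (S_fence_filters n)"
  by (rule finite_subset[of _ "Pow {1..n}"]) (auto simp: S_fence_filters_def S_fence_elems_def)

lemma Phi_degree_less:
  assumes "F \<in> S_fence_filters n"
  shows "Phi_degree n F < card (S_fence_filters n)"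
proof -
  let ?V = "S_fence_filters n"
  have sub: "{e \<in> Phi_edges n. F \<in> e} \<subseteq> (\<lambda>G. {F, G}) ` (?V - {F})"
  proof
    fix e assume "e \<in> {e \<in> Phi_edges n. F \<in> e}"
    then obtain A B where e: "e = {A, B}" "filter_covered_by n A B" "F = A \<or> F = B"
      unfolding Phi_edges_def by auto
    then have "A \<in> ?V" "B \<in> ?V" "A \<noteq> B" unfolding filter_covered_by_def by auto
    then show "e \<in> (\<lambda>G. {F, G}) ` (?V - {F})" using e by (auto simp: insert_commute)
  qed
  have fin: "finite (?V - {F})" using finite_S_fence_filters by simp
  have "Phi_degree n F \<le> card (?V - {F})"
    unfolding Phi_degree_def using surj_card_le[OF fin sub] .
  also have "\<dots> < card ?V" using assms finite_S_fence_filters by (intro card_Diff1_less) auto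
  finally show ?thesis .
qed

lemma coeff_degree_poly: "coeff (degree_poly n) k = int (degree_count n k)"
proof (cases "k < card (S_fence_filters n)")
  case True
  then show ?thesis by (simp add: degree_poly_def coeff_sum)
next
  case False
  then have "{F \<in> S_fence_filters n. Phi_degree n F = k} = {}" using Phi_degree_less by auto
  then have "degree_count n k = 0" unfolding degree_count_def by (metis card.empty)
  then show ?thesis using False by (simp add: degree_poly_def coeff_sum)
qed

end

theory Submission
  imports Defs
begin

text \<open>Two filters are adjacent iff they differ in one element, so the degree of a filter is the
  number of elements whose membership can be toggled. Appending an element to a fence with at least
  four elements affects only the last element, which is described by three states (excited, free,
  blocked). The resulting 3 by 3 transfer matrix has a characteristic polynomial that is the
  reversed denominator of the generating function, and the fences with at most four elements
  supply the initial values.\<close>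

section \<open>Filters described by cover relations\<close>

lemma mem_filters_iff:
  "F \<in> S_fence_filters n \<longleftrightarrow> F \<subseteq> {1..n} \<and> (\<forall>(a, b)\<in>S_fence_covers n. a \<in> F \<longrightarrow> b \<in> F)"
proof
  assume F: "F \<in> S_fence_filters n"
  have "b \<in> F" if "(a, b) \<in> S_fence_covers n" "a \<in> F" for a b
  proof -
    have "S_fence_le n a b"
      using that(1) by (auto simp: S_fence_le_def S_fence_covers_def)
    then show ?thesis using F that(2) by (auto simp: S_fence_filters_def)
  qed
  then show "F \<subseteq> {1..n} \<and> (\<forall>(a, b)\<in>S_fence_covers n. a \<in> F \<longrightarrow> b \<in> F)"
    using F by (auto simp: S_fence_filters_def S_fence_elems_def)
next
  assume F: "F \<subseteq> {1..n} \<and> (\<forall>(a, b)\<in>S_fence_covers n. a \<in> F \<longrightarrow> b \<in> F)"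
  \<comment> \<open>Closure passes from the covers to the whole order by induction along a chain of
    covers.\<close>
  have "b \<in> F" if "(a, b) \<in> (S_fence_covers n)\<^sup>*" "a \<in> F" for a b
    using that F by (induction rule: rtrancl_induct) auto
  then show "F \<in> S_fence_filters n"
    using F by (auto simp: S_fence_filters_def S_fence_le_def S_fence_elems_def)
qed

lemma filters_subset: "F \<in> S_fence_filters n \<Longrightarrow> F \<subseteq> {1..n}"
  by (simp add: mem_filters_iff)

subsection \<open>Degrees as numbers of admissible toggles\<close>

definition toggle :: "'a \<Rightarrow> 'a set \<Rightarrow> 'a set" where
  "toggle v F = (if v \<in> F then F - {v} else insert v F)"

lemma toggle_neq: "toggle v F \<noteq> F"
  by (auto simp: toggle_def)

lemma toggle_inject: "toggle v F = toggle w F \<longleftrightarrow> v = w"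
  by (auto simp: toggle_def split: if_splits)

text \<open>A rank that increases strictly along every cover. Only \<open>x_2\<close> has elements
  both above and below it, whence the single middle level. Maximizing this number yields an element
  that is maximal in a given finite set.\<close>

definition fence_height :: "nat \<Rightarrow> nat" where
  "fence_height v = (if v = 2 then 1 else if v = 1 \<or> even v then 2 else 0)"

lemma covers_height:
  "(a, b) \<in> S_fence_covers n \<Longrightarrow> fence_height a < fence_height b"
  by (auto simp: S_fence_covers_def fence_height_def split: if_splits)

text \<open>Take \<open>v\<close> of greatest height in \<open>F - G\<close>. Whatever covers
  \<open>v\<close> lies in \<open>F\<close>, and being higher it cannot lie in \<open>F - G\<close>,
  so it is already in \<open>G\<close>.\<close>

lemma ex_filter_insert:
  assumes F: "F \<in> S_fence_filters n" and G: "G \<in> S_fence_filters n" and "G \<subset> F"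
  obtains v where "v \<in> F - G" "insert v G \<in> S_fence_filters n"
proof -
  have "finite F" using filters_subset[OF F] by (rule finite_subset) simp
  then have "finite (F - G)" "F - G \<noteq> {}" using \<open>G \<subset> F\<close> by auto
  then obtain v where v: "v \<in> F - G" "fence_height v = Max (fence_height ` (F - G))"
    using obtains_MAX[of "F - G" fence_height] by metis
  have max: "fence_height w \<le> fence_height v" if "w \<in> F - G" for w
    using that \<open>finite (F - G)\<close> by (simp add: v(2))
  have "b \<in> insert v G" if c: "(a, b) \<in> S_fence_covers n" and a: "a \<in> insert v G" for a b
  proof (cases "a = v")
    case True
    have "b \<in> F" using c v(1) True F by (auto simp: mem_filters_iff)
    then show ?thesis using max[of b] covers_height[OF c] True by auto
  next
    case False
    then show ?thesis using c a G by (auto simp: mem_filters_iff)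
  qed
  then have "insert v G \<in> S_fence_filters n"
    using filters_subset[OF F] filters_subset[OF G] v(1) by (auto simp: mem_filters_iff)
  with v(1) show thesis by (rule that)
qed

text \<open>If \<open>G\<close> is a proper subset of \<open>F\<close>, then
  \<open>ex_filter_insert\<close> gives a filter \<open>insert v G\<close> between them; in a
  covering pair it must be \<open>F\<close> itself.\<close>

lemma filter_covered_by_iff:
  "filter_covered_by n F G \<longleftrightarrow>
     F \<in> S_fence_filters n \<and> G \<in> S_fence_filters n \<and> (\<exists>v\<in>F. G = F - {v})"
proof
  assume cov: "filter_covered_by n F G"
  then have FG: "F \<in> S_fence_filters n" "G \<in> S_fence_filters n" "G \<subset> F"
    by (auto simp: filter_covered_by_def)
  then obtain v where v: "v \<in> F - G" "insert v G \<in> S_fence_filters n"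
    by (rule ex_filter_insert)
  then have "insert v G = F"
    using cov FG(3) by (auto simp: filter_covered_by_def)
  then show "F \<in> S_fence_filters n \<and> G \<in> S_fence_filters n \<and> (\<exists>v\<in>F. G = F - {v})"
    using FG v(1) by auto
next
  assume "F \<in> S_fence_filters n \<and> G \<in> S_fence_filters n \<and> (\<exists>v\<in>F. G = F - {v})"
  then show "filter_covered_by n F G"
    by (auto simp: filter_covered_by_def)
qed

text \<open>Toggling is an involution, so an edge has the same form seen from either end, and
  insertion and removal need not be distinguished when degrees are counted.\<close>

lemma Phi_edges_eq:
  "Phi_edges n = {{F, toggle v F} | F v. F \<in> S_fence_filters n \<and> toggle v F \<in> S_fence_filters n}"
  (is "_ = ?R")
proof (intro equalityI subsetI)
  fix e assume "e \<in> Phi_edges n"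
  then show "e \<in> ?R"
    unfolding Phi_edges_def filter_covered_by_iff toggle_def by fastforce
next
  fix e assume "e \<in> ?R"
  then obtain F v where e: "e = {F, toggle v F}"
    and mem: "F \<in> S_fence_filters n" "toggle v F \<in> S_fence_filters n" by auto
  show "e \<in> Phi_edges n"
  proof (cases "v \<in> F")
    case True
    then have "filter_covered_by n F (toggle v F)"
      using mem by (auto simp: filter_covered_by_iff toggle_def)
    then show ?thesis using e by (auto simp: Phi_edges_def)
  next
    case False
    then have "filter_covered_by n (toggle v F) F"
      using mem by (auto simp: filter_covered_by_iff toggle_def)
    then show ?thesis using e by (auto simp: Phi_edges_def)
  qed
qed

lemma toggle_toggle: "toggle v (toggle v F) = F"
  by (auto simp: toggle_def)

text \<open>Written as a sum of indicators so that the summand of the last element can be split off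
  and explicit cases can be evaluated.\<close>

definition toggle_degree :: "nat \<Rightarrow> nat set \<Rightarrow> nat" where
  "toggle_degree n F = (\<Sum>v = 1..n. of_bool (toggle v F \<in> S_fence_filters n))"

text \<open>Edges at \<open>F\<close> correspond bijectively to admissible toggles: distinct
  elements give distinct neighbours, and toggling an element outside the fence never gives a
  filter.\<close>

lemma Phi_degree_eq:
  assumes F: "F \<in> S_fence_filters n"
  shows "Phi_degree n F = toggle_degree n F"
proof -
  let ?T = "{v \<in> {1..n}. toggle v F \<in> S_fence_filters n}"
  have range: "v \<in> {1..n}" if "toggle v F \<in> S_fence_filters n" for v
    using that filters_subset[OF F] filters_subset[OF that]
    by (cases "v \<in> F") (auto simp: toggle_def)
  have "{e \<in> Phi_edges n. F \<in> e} = (\<lambda>v. {F, toggle v F}) ` ?T" (is "?L = ?R")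
  proof (intro equalityI subsetI)
    fix e assume "e \<in> ?L"
    then obtain G v where e: "e = {G, toggle v G}" "F = G \<or> F = toggle v G"
      and mem: "G \<in> S_fence_filters n" "toggle v G \<in> S_fence_filters n"
      by (auto simp: Phi_edges_eq)
    then have "toggle v F \<in> S_fence_filters n" "e = {F, toggle v F}"
      by (auto simp: toggle_toggle)
    then show "e \<in> ?R" using range by blast
  next
    fix e assume "e \<in> ?R"
    then show "e \<in> ?L" using F by (auto simp: Phi_edges_eq)
  qed
  moreover have "inj_on (\<lambda>v. {F, toggle v F}) ?T"
    by (auto intro!: inj_onI simp: doubleton_eq_iff toggle_inject toggle_neq)
  ultimately have "Phi_degree n F = card ?T"
    by (simp add: Phi_degree_def card_image)
  then show ?thesis
    by (simp add: toggle_degree_def sum.If_cases of_bool_def Int_def)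
qed

text \<open>The degree polynomial restricted to a set of filters, so that each state of the last
  element can be counted separately.\<close>

definition degree_weight :: "nat \<Rightarrow> nat set set \<Rightarrow> int poly" where
  "degree_weight n S = (\<Sum>F\<in>S. [:0, 1:] ^ toggle_degree n F)"

lemma degree_poly_eq: "degree_poly n = degree_weight n (S_fence_filters n)"
proof (rule poly_eqI)
  fix k
  have "coeff ([:0, 1 :: int:] ^ d) k = of_bool (d = k)" for d
  proof -
    have "[:0, 1 :: int:] ^ d = monom 1 d" by (simp add: monom_altdef)
    then show ?thesis by simp
  qed
  then have "coeff (degree_weight n (S_fence_filters n)) k =
      int (card {F \<in> S_fence_filters n. toggle_degree n F = k})"
    by (simp add: degree_weight_def coeff_sum finite_S_fence_filters sum.If_cases of_bool_def Int_def)
  also have "{F \<in> S_fence_filters n. toggle_degree n F = k} =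
      {F \<in> S_fence_filters n. Phi_degree n F = k}"
    using Phi_degree_eq by auto
  finally show "coeff (degree_poly n) k = coeff (degree_weight n (S_fence_filters n)) k"
    by (simp add: coeff_degree_poly degree_count_def)
qed

subsection \<open>The transfer recurrence\<close>

text \<open>Complementing membership at even indices turns the filter condition on \<open>x\<^sub>4, x\<^sub>5, \<dots>\<close> into:
  no two consecutive elements are excited. An element can then be toggled iff none of its
  neighbours is excited.\<close>

definition excited :: "nat \<Rightarrow> nat set \<Rightarrow> bool" where
  "excited m F \<longleftrightarrow> (odd m \<longleftrightarrow> m \<in> F)"

text \<open>The flag \<open>s\<close> prescribes whether the new element is excited, not whether it
  is a member; this removes the parity of \<open>n\<close> from the recurrence.\<close>

definition extend :: "nat \<Rightarrow> bool \<Rightarrow> nat set \<Rightarrow> nat set" where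
  "extend n s G = (if odd (Suc n) = s then insert (Suc n) G else G)"

lemma mem_covers_iff:
  "(a, b) \<in> S_fence_covers n \<longleftrightarrow> a \<in> {1..n} \<and> b \<in> {1..n} \<and>
    ((a, b) \<in> {(2, 1), (3, 2), (2, 4), (5, 4)} \<or>
     even b \<and> b \<ge> 6 \<and> (b = Suc a \<or> a = Suc b))"
proof -
  have "(a, b) \<in> (\<Union>i\<in>{3..}. {(2 * i - 1, 2 * i), (2 * i + 1, 2 * i)}) \<longleftrightarrow>
      even b \<and> b \<ge> 6 \<and> (b = Suc a \<or> a = Suc b)" (is "?L \<longleftrightarrow> ?R")
  proof
    assume ?R
    then show ?L by (intro UN_I[of "b div 2"]) (auto elim!: evenE)
  qed auto
  then show ?thesis
    unfolding S_fence_covers_def S_fence_elems_def by blast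
qed

text \<open>From index 4 on the fence is a zigzag: \<open>x_5\<close> lies below \<open>x_4\<close>,
  and each later element is likewise comparable by a cover to its predecessor only. The bound
  excludes the irregular start, where \<open>x_4\<close> is attached to \<open>x_2\<close>.\<close>

lemma covers_Suc:
  assumes n: "n \<ge> 4"
  shows "S_fence_covers (Suc n) =
    insert (if even n then (Suc n, n) else (n, Suc n)) (S_fence_covers n)"
proof -
  have "(a, b) \<in> S_fence_covers (Suc n) \<longleftrightarrow>
      a = Suc n \<and> b = n \<and> even n \<or> a = n \<and> b = Suc n \<and> odd n \<or> (a, b) \<in> S_fence_covers n" for a b
  proof -
    \<comment> \<open>For odd \<open>n\<close> the new upper element \<open>Suc n\<close> is then at
      least 6, as the general clause of \<open>mem_covers_iff\<close> demands.\<close>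
    have odd: "n \<ge> 5" if "odd n" using n that by presburger
    consider "a \<le> n" "b \<le> n" | "a = Suc n" | "b = Suc n" | "a > Suc n \<or> b > Suc n" by linarith
    then show ?thesis
    proof cases
      case 1
      then show ?thesis by (auto simp: mem_covers_iff)
    next
      case 2
      then show ?thesis using n by (cases "b = n") (auto simp: mem_covers_iff)
    next
      case 3
      then show ?thesis using n odd by (cases "a = n") (auto simp: mem_covers_iff)
    next
      case 4
      then show ?thesis by (auto simp: mem_covers_iff)
    qed
  qed
  then show ?thesis by (intro subset_antisym subrelI) (auto split: if_splits)
qed

text \<open>The old covers do not mention \<open>Suc n\<close>, and the single new cover is violated
  exactly when \<open>n\<close> and \<open>Suc n\<close> are both excited, whichever of the two is
  the upper one.\<close>

lemma extend_mem_filters_iff: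
  assumes n: "n \<ge> 4" and G: "G \<subseteq> {1..n}"
  shows "extend n s G \<in> S_fence_filters (Suc n) \<longleftrightarrow>
    G \<in> S_fence_filters n \<and> \<not> (excited n G \<and> s)"
proof -
  have range: "a \<noteq> Suc n \<and> b \<noteq> Suc n" if "(a, b) \<in> S_fence_covers n" for a b
    using that by (auto simp: S_fence_covers_def S_fence_elems_def)
  have eq: "(\<forall>(a, b)\<in>S_fence_covers n. a \<in> extend n s G \<longrightarrow> b \<in> extend n s G) \<longleftrightarrow>
      (\<forall>(a, b)\<in>S_fence_covers n. a \<in> G \<longrightarrow> b \<in> G)"
    by (intro ball_cong refl) (use range in \<open>auto simp: extend_def\<close>)
  have sub: "extend n s G \<subseteq> {1..Suc n}"
    using G by (auto simp: extend_def)
  have "Suc n \<notin> G" using G by auto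
  then show ?thesis
    using G sub
    unfolding mem_filters_iff covers_Suc[OF n] ball_simps eq
    by (auto simp: extend_def excited_def split: if_splits)
qed

section \<open>Toggles of an extended filter\<close>

lemma toggle_subset: "v \<in> A \<Longrightarrow> G \<subseteq> A \<Longrightarrow> toggle v G \<subseteq> A"
  by (auto simp: toggle_def)

lemma toggle_extend: "v \<le> n \<Longrightarrow> toggle v (extend n s G) = extend n s (toggle v G)"
  by (auto simp: toggle_def extend_def)

lemma toggle_Suc_extend: "G \<subseteq> {1..n} \<Longrightarrow> toggle (Suc n) (extend n s G) = extend n (\<not> s) G"
  by (auto simp: toggle_def extend_def)

lemma excited_toggle: "excited m (toggle v G) \<longleftrightarrow> (if v = m then \<not> excited m G else excited m G)"
  by (auto simp: toggle_def excited_def)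

lemma excited_Suc_extend: "G \<subseteq> {1..n} \<Longrightarrow> excited (Suc n) (extend n s G) = s"
  by (auto simp: extend_def excited_def)

text \<open>For even \<open>n\<close> the last element is maximal and, if excited, absent, so it may
  be added; for odd \<open>n\<close> it is minimal and present, so it may be removed.\<close>

lemma toggle_excited:
  assumes n: "n \<ge> 4" and F: "F \<in> S_fence_filters n" and "excited n F"
  shows "toggle n F \<in> S_fence_filters n"
proof -
  have "even n \<Longrightarrow> (n, b) \<notin> S_fence_covers n" "odd n \<Longrightarrow> (b, n) \<notin> S_fence_covers n" for b
    using n by (auto simp: S_fence_covers_def)
  moreover have "toggle n F \<subseteq> {1..n}"
    using n filters_subset[OF F] by (intro toggle_subset) auto
  ultimately show ?thesis
    using F \<open>excited n F\<close> by (auto simp: mem_filters_iff toggle_def excited_def)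
qed

lemma toggle_degree_split:
  "n \<ge> 4 \<Longrightarrow> toggle_degree n G =
    (\<Sum>v = 1..<n. of_bool (toggle v G \<in> S_fence_filters n)) +
    of_bool (toggle n G \<in> S_fence_filters n)"
  unfolding toggle_degree_def
  by (cases n) (simp_all add: atLeastLessThanSuc_atLeastAtMost)

text \<open>Only the toggles of \<open>n\<close> and \<open>Suc n\<close> matter. The former stays
  admissible unless it would excite \<open>n\<close> next to an excited \<open>Suc n\<close>; the
  latter is admissible unless it would excite \<open>Suc n\<close> next to an excited
  \<open>n\<close>. The old contribution of \<open>n\<close> stands on the left to avoid subtraction
  on naturals.\<close>

lemma toggle_degree_extend:
  assumes n: "n \<ge> 4" and G: "G \<in> S_fence_filters n" and s: "\<not> (excited n G \<and> s)"
  shows "toggle_degree (Suc n) (extend n s G) + of_bool (toggle n G \<in> S_fence_filters n) =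
    toggle_degree n G + of_bool (toggle n G \<in> S_fence_filters n \<and> (excited n G \<or> \<not> s)) +
    of_bool (\<not> excited n G \<or> s)"
proof -
  have sub: "toggle v G \<subseteq> {1..n}" if "v \<in> {1..n}" for v
    using that filters_subset[OF G] by (rule toggle_subset)
  have ext: "toggle v (extend n s G) \<in> S_fence_filters (Suc n) \<longleftrightarrow>
      toggle v G \<in> S_fence_filters n \<and> \<not> (excited n (toggle v G) \<and> s)" if "v \<in> {1..n}" for v
    using that n sub[OF that] by (simp add: toggle_extend extend_mem_filters_iff)
  have "toggle_degree (Suc n) (extend n s G) =
      (\<Sum>v = 1..<n. of_bool (toggle v (extend n s G) \<in> S_fence_filters (Suc n))) +
      of_bool (toggle n (extend n s G) \<in> S_fence_filters (Suc n)) +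
      of_bool (toggle (Suc n) (extend n s G) \<in> S_fence_filters (Suc n))"
    using n by (simp add: toggle_degree_split)
  \<comment> \<open>A toggle at \<open>v < n\<close> leaves the state of \<open>n\<close> unchanged,
    so the condition at the new cover still holds by the assumption on \<open>s\<close>.\<close>
  also have "(\<Sum>v = 1..<n. of_bool (toggle v (extend n s G) \<in> S_fence_filters (Suc n))) =
      (\<Sum>v = 1..<n. of_bool (toggle v G \<in> S_fence_filters n) :: nat)"
    using s by (intro sum.cong) (auto simp: ext excited_toggle)
  finally show ?thesis
    using n G s toggle_degree_split[OF n, of G] filters_subset[OF G]
    by (simp add: ext excited_toggle toggle_Suc_extend extend_mem_filters_iff)
qed

text \<open>The states of the last element. For \<open>n \<ge> 4\<close> an excited one can always
  be toggled by \<open>toggle_excited\<close>, so only the unexcited case is subdivided.\<close>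

definition excited_filters :: "nat \<Rightarrow> nat set set" where
  "excited_filters n = {F \<in> S_fence_filters n. excited n F}"

definition free_filters :: "nat \<Rightarrow> nat set set" where
  "free_filters n = {F \<in> S_fence_filters n. \<not> excited n F \<and> toggle n F \<in> S_fence_filters n}"

definition blocked_filters :: "nat \<Rightarrow> nat set set" where
  "blocked_filters n = {F \<in> S_fence_filters n. \<not> excited n F \<and> toggle n F \<notin> S_fence_filters n}"

lemmas filter_class_defs = excited_filters_def free_filters_def blocked_filters_def

lemma filters_Suc_cases:
  assumes n: "n \<ge> 4" and F: "F \<in> S_fence_filters (Suc n)"
  obtains s G where "F = extend n s G" "G \<in> S_fence_filters n" "\<not> (excited n G \<and> s)"
proof -
  define G where "G = F - {Suc n}"
  have G: "G \<subseteq> {1..n}" using filters_subset[OF F] by (auto simp: G_def)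
  have eq: "F = extend n (excited (Suc n) F) G"
    by (auto simp: G_def extend_def excited_def)
  show thesis
    using eq F that extend_mem_filters_iff[OF n G] by metis
qed

text \<open>The new element can be excited only over an unexcited \<open>n\<close>. If it is
  unexcited, it is free when \<open>n\<close> is unexcited and blocked when \<open>n\<close> is
  excited.\<close>

lemma filter_classes_Suc:
  assumes n: "n \<ge> 4"
  shows "excited_filters (Suc n) = extend n True ` (free_filters n \<union> blocked_filters n)"
    and "free_filters (Suc n) = extend n False ` (free_filters n \<union> blocked_filters n)"
    and "blocked_filters (Suc n) = extend n False ` excited_filters n"
proof -
  have *: "extend n s G \<in> S_fence_filters (Suc n) \<longleftrightarrow> \<not> (excited n G \<and> s)"
      "excited (Suc n) (extend n s G) = s"
      "toggle (Suc n) (extend n s G) \<in> S_fence_filters (Suc n) \<longleftrightarrow> \<not> (excited n G \<and> \<not> s)"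
    if "G \<in> S_fence_filters n" for G s
    using that filters_subset[OF that] n
    by (simp_all add: extend_mem_filters_iff excited_Suc_extend toggle_Suc_extend)
  \<comment> \<open>Any subfamily of the filters splits by the state of the new element; the three
    classes are instances of \<open>P\<close>.\<close>
  have dec: "{F \<in> S_fence_filters (Suc n). P F} =
      extend n True ` {G \<in> S_fence_filters n. \<not> excited n G \<and> P (extend n True G)} \<union>
      extend n False ` {G \<in> S_fence_filters n. P (extend n False G)}" for P
  proof (intro equalityI subsetI)
    fix F assume F: "F \<in> {F \<in> S_fence_filters (Suc n). P F}"
    then obtain s G where "F = extend n s G" "G \<in> S_fence_filters n" "\<not> (excited n G \<and> s)"
      using filters_Suc_cases[OF n] by blast
    then show "F \<in> extend n True ` {G \<in> S_fence_filters n. \<not> excited n G \<and> P (extend n True G)} \<union>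
        extend n False ` {G \<in> S_fence_filters n. P (extend n False G)}"
      using F by (cases s) auto
  qed (auto simp: *)
  show "excited_filters (Suc n) = extend n True ` (free_filters n \<union> blocked_filters n)"
    unfolding filter_class_defs dec by (auto simp: *)
  show "free_filters (Suc n) = extend n False ` (free_filters n \<union> blocked_filters n)"
    unfolding filter_class_defs dec by (auto simp: *)
  show "blocked_filters (Suc n) = extend n False ` excited_filters n"
    unfolding filter_class_defs dec by (auto simp: *)
qed

lemma inj_on_extend: "inj_on (extend n s) (S_fence_filters n)"
proof (rule inj_onI)
  fix F G assume "F \<in> S_fence_filters n" "G \<in> S_fence_filters n" "extend n s F = extend n s G"
  moreover from this have "Suc n \<notin> F" "Suc n \<notin> G" using filters_subset by fastforce+
  ultimately show "F = G" by (simp add: extend_def insert_ident split: if_splits)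
qed

lemma degree_weight_extend:
  assumes "S \<subseteq> S_fence_filters n"
    and "\<And>G. G \<in> S \<Longrightarrow> toggle_degree (Suc n) (extend n s G) = toggle_degree n G + d"
  shows "degree_weight (Suc n) (extend n s ` S) = [:0, 1:] ^ d * degree_weight n S"
proof -
  have "inj_on (extend n s) S" using inj_on_extend assms(1) by (rule inj_on_subset)
  then show ?thesis
    using assms(2) by (simp add: degree_weight_def sum.reindex power_add sum_distrib_left mult.commute)
qed

lemma degree_weight_Un:
  assumes "S \<union> T \<subseteq> S_fence_filters n" "S \<inter> T = {}"
  shows "degree_weight n (S \<union> T) = degree_weight n S + degree_weight n T"
  using assms finite_S_fence_filters[of n] unfolding degree_weight_def
  by (intro sum.union_disjoint) (auto dest: finite_subset)

text \<open>These are the rows of the transfer matrix. On each combination of old class and new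
  state the degree changes by a constant, which becomes the exponent of \<open>X\<close>.\<close>

lemma degree_weight_Suc:
  fixes n :: nat
  assumes n: "n \<ge> 4"
  defines "X \<equiv> [:0, 1 :: int:]"
  shows "degree_weight (Suc n) (excited_filters (Suc n)) =
      degree_weight n (free_filters n) + X * degree_weight n (blocked_filters n)"
    and "degree_weight (Suc n) (free_filters (Suc n)) =
      X * (degree_weight n (free_filters n) + degree_weight n (blocked_filters n))"
    and "degree_weight (Suc n) (blocked_filters (Suc n)) = degree_weight n (excited_filters n)"
proof -
  have sub: "excited_filters n \<subseteq> S_fence_filters n" "free_filters n \<subseteq> S_fence_filters n"
      "blocked_filters n \<subseteq> S_fence_filters n"
    by (auto simp: filter_class_defs)
  have disj: "free_filters n \<inter> blocked_filters n = {}"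
    by (auto simp: filter_class_defs)
  have sub': "extend n s ` (free_filters n \<union> blocked_filters n) \<subseteq> S_fence_filters (Suc n)" for s
    using n filters_subset by (auto simp: filter_class_defs extend_mem_filters_iff)
  have disj': "extend n s ` free_filters n \<inter> extend n s ` blocked_filters n = {}" for s
    using inj_on_image_Int[OF inj_on_extend sub(2,3)] disj by (metis image_empty)
  note split = degree_weight_Un[OF sub'[unfolded image_Un] disj']
  \<comment> \<open>The excited \<open>n\<close> can still be toggled, and the new element is
    blocked by it: no change.\<close>
  have E: "degree_weight (Suc n) (extend n False ` excited_filters n) =
      X ^ 0 * degree_weight n (excited_filters n)"
    unfolding X_def
  proof (rule degree_weight_extend)
    show "toggle_degree (Suc n) (extend n False G) = toggle_degree n G + 0"
      if "G \<in> excited_filters n" for G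
      using that toggle_degree_extend[OF n, of G False] toggle_excited[OF n, of G]
      by (simp add: filter_class_defs)
  qed (rule sub)
  \<comment> \<open>The toggle of \<open>n\<close> is lost to its excited neighbour and that of
    \<open>Suc n\<close> is gained: no change.\<close>
  have Ft: "degree_weight (Suc n) (extend n True ` free_filters n) =
      X ^ 0 * degree_weight n (free_filters n)"
    unfolding X_def
  proof (rule degree_weight_extend)
    show "toggle_degree (Suc n) (extend n True G) = toggle_degree n G + 0"
      if "G \<in> free_filters n" for G
      using that toggle_degree_extend[OF n, of G True] by (simp add: filter_class_defs)
  qed (rule sub)
  \<comment> \<open>The toggle of \<open>n\<close> survives and that of \<open>Suc n\<close> is
    gained.\<close>
  have Ff: "degree_weight (Suc n) (extend n False ` free_filters n) =
      X ^ 1 * degree_weight n (free_filters n)"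
    unfolding X_def
  proof (rule degree_weight_extend)
    show "toggle_degree (Suc n) (extend n False G) = toggle_degree n G + 1"
      if "G \<in> free_filters n" for G
      using that toggle_degree_extend[OF n, of G False] by (simp add: filter_class_defs)
  qed (rule sub)
  \<comment> \<open>There is no toggle of \<open>n\<close> to lose, and \<open>Suc n\<close> can be
    toggled in either state.\<close>
  have B: "degree_weight (Suc n) (extend n s ` blocked_filters n) =
      X ^ 1 * degree_weight n (blocked_filters n)" for s
    unfolding X_def
  proof (rule degree_weight_extend)
    show "toggle_degree (Suc n) (extend n s G) = toggle_degree n G + 1"
      if "G \<in> blocked_filters n" for G
      using that toggle_degree_extend[OF n, of G s] by (simp add: filter_class_defs)
  qed (rule sub)
  show "degree_weight (Suc n) (excited_filters (Suc n)) =
      degree_weight n (free_filters n) + X * degree_weight n (blocked_filters n)"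
    by (simp add: filter_classes_Suc[OF n] image_Un split Ft B)
  show "degree_weight (Suc n) (free_filters (Suc n)) =
      X * (degree_weight n (free_filters n) + degree_weight n (blocked_filters n))"
    by (simp add: filter_classes_Suc[OF n] image_Un split Ff B distrib_left)
  show "degree_weight (Suc n) (blocked_filters (Suc n)) = degree_weight n (excited_filters n)"
    by (simp add: filter_classes_Suc[OF n] E)
qed

lemma degree_poly_split:
  "degree_poly n = degree_weight n (excited_filters n) +
     degree_weight n (free_filters n) + degree_weight n (blocked_filters n)"
proof -
  have "S_fence_filters n = excited_filters n \<union> (free_filters n \<union> blocked_filters n)"
    by (auto simp: filter_class_defs)
  moreover have "degree_weight n (excited_filters n \<union> (free_filters n \<union> blocked_filters n)) =
      degree_weight n (excited_filters n) +
      (degree_weight n (free_filters n) + degree_weight n (blocked_filters n))"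
    by (subst degree_weight_Un degree_weight_Un; auto simp: filter_class_defs)+
  ultimately show ?thesis by (simp add: degree_poly_eq add.assoc)
qed

subsection \<open>Small fences\<close>

lemma small_intervals:
  "{1..1 :: nat} = {1}" "{1..2 :: nat} = {1, 2}" "{1..3 :: nat} = {1, 2, 3}"
  "{1..4 :: nat} = {1, 2, 3, 4}"
  by auto

lemma small_covers:
  "S_fence_covers 0 = {}" "S_fence_covers 1 = {}" "S_fence_covers 2 = {(2, 1)}"
  "S_fence_covers 3 = {(2, 1), (3, 2)}" "S_fence_covers 4 = {(2, 1), (3, 2), (2, 4)}"
  by (auto simp: S_fence_covers_def S_fence_elems_def)

text \<open>Selecting from an explicit power set makes the small cases computable by
  evaluation.\<close>

lemma filters_eq_Collect:
  "S_fence_filters n = {F \<in> Pow {1..n}. \<forall>(a, b)\<in>S_fence_covers n. a \<in> F \<longrightarrow> b \<in> F}"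
  by (rule set_eqI) (simp add: mem_filters_iff)

text \<open>Lets the simplifier decide equality of explicitly listed sets, as the side condition
  \<open>F \<notin> S\<close> of \<open>degree_weight_insert\<close> requires.\<close>

lemma insert_eq_insert_iff:
  "insert a A = insert b B \<longleftrightarrow>
    a \<in> insert b B \<and> A \<subseteq> insert b B \<and> b \<in> insert a A \<and> B \<subseteq> insert a A"
  by auto

lemma small_filters:
  "S_fence_filters 0 = {{}}"
  "S_fence_filters 1 = {{}, {1}}"
  "S_fence_filters 2 = {{}, {1}, {1, 2}}"
  "S_fence_filters 3 = {{}, {1}, {1, 2}, {1, 2, 3}}"
  "S_fence_filters 4 = {{}, {1}, {4}, {1, 4}, {1, 2, 4}, {1, 2, 3, 4}}"
  unfolding filters_eq_Collect small_covers small_intervals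
  by code_simp+

lemma small_degrees:
  "toggle_degree 0 {} = 0"
  "toggle_degree 1 {} = 1" "toggle_degree 1 {1} = 1"
  "toggle_degree 2 {} = 1" "toggle_degree 2 {1} = 2" "toggle_degree 2 {1, 2} = 1"
  "toggle_degree 3 {} = 1" "toggle_degree 3 {1} = 2" "toggle_degree 3 {1, 2} = 2"
  "toggle_degree 3 {1, 2, 3} = 1"
  "toggle_degree 4 {} = 2" "toggle_degree 4 {1} = 2" "toggle_degree 4 {4} = 2"
  "toggle_degree 4 {1, 4} = 3" "toggle_degree 4 {1, 2, 4} = 2" "toggle_degree 4 {1, 2, 3, 4} = 1"
  unfolding toggle_degree_def small_filters small_intervals by code_simp+

lemma small_classes:
  "excited_filters 4 = {{}, {1}}" "free_filters 4 = {{4}, {1, 4}}"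
  "blocked_filters 4 = {{1, 2, 4}, {1, 2, 3, 4}}"
  unfolding filter_class_defs small_filters by code_simp+

lemma degree_weight_insert:
  "finite S \<Longrightarrow> F \<notin> S \<Longrightarrow>
    degree_weight n (insert F S) = [:0, 1:] ^ toggle_degree n F + degree_weight n S"
  by (simp add: degree_weight_def)

lemma degree_weight_empty: "degree_weight n {} = 0"
  by (simp add: degree_weight_def)

text \<open>The variable is kept opaque, as the simplifier would otherwise expand all polynomials into
  coefficient lists.\<close>

lemma small_degree_polys:
  assumes X: "X = [:0, 1 :: int:]"
  shows "degree_poly 0 = 1" "degree_poly 1 = 2 * X" "degree_poly 2 = 2 * X + X ^ 2"
    "degree_poly 3 = 2 * X + 2 * X ^ 2"
  unfolding degree_poly_eq small_filters
  by (simp_all add: degree_weight_insert[folded X] degree_weight_empty small_degrees[simplified]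
      insert_eq_insert_iff)

lemma small_class_weights:
  assumes X: "X = [:0, 1 :: int:]"
  shows "degree_weight 4 (excited_filters 4) = 2 * X ^ 2"
    "degree_weight 4 (free_filters 4) = X ^ 2 + X ^ 3"
    "degree_weight 4 (blocked_filters 4) = X + X ^ 2"
  unfolding small_classes
  by (simp_all add: degree_weight_insert[folded X] degree_weight_empty small_degrees[simplified]
      insert_eq_insert_iff)

subsection \<open>The generating function\<close>

text \<open>The coefficients of the rational function in the theorem: they differ from the degree
  polynomials only at the indices 1 and 2, which the polynomial summand corrects, and satisfy
  the recurrence from the start.\<close>

definition adjusted_poly :: "nat \<Rightarrow> int poly" where
  "adjusted_poly n =
    (if n = 1 then 1 + [:0, 1:] else if n = 2 then 2 * [:0, 1:] else degree_poly n)"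

text \<open>For \<open>n \<ge> 4\<close> this is Cayley-Hamilton for the transfer matrix, whose
  characteristic polynomial is \<open>t^3 - X t^2 - X t - (X - X^2)\<close>; unfolding three steps
  verifies it directly. The indices below 4 are checked from the initial values.\<close>

lemma adjusted_poly_rec:
  fixes X :: "int poly" defines "X \<equiv> [:0, 1:]"
  shows "adjusted_poly (n + 3) =
    X * adjusted_poly (n + 2) + X * adjusted_poly (n + 1) + (X - X ^ 2) * adjusted_poly n"
proof -
  define A where "A n = degree_weight n (excited_filters n)" for n
  define B where "B n = degree_weight n (free_filters n)" for n
  define C where "C n = degree_weight n (blocked_filters n)" for n
  have D: "degree_poly n = A n + B n + C n" for n
    by (simp add: A_def B_def C_def degree_poly_split)
  have step: "A (Suc n) = B n + X * C n" "B (Suc n) = X * (B n + C n)" "C (Suc n) = A n"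
    if "n \<ge> 4" for n
    using degree_weight_Suc[OF that] by (simp_all add: A_def B_def C_def X_def)
  have base: "A 4 = 2 * X ^ 2" "B 4 = X ^ 2 + X ^ 3" "C 4 = X + X ^ 2"
    by (simp_all add: A_def B_def C_def small_class_weights[OF X_def[THEN meta_eq_to_obj_eq]])
  have five: "A 5 = B 4 + X * C 4" "B 5 = X * (B 4 + C 4)" "C 5 = A 4"
    using step[of 4] by simp_all
  have six: "A 6 = B 5 + X * C 5" "B 6 = X * (B 5 + C 5)" "C 6 = A 5"
    using step[of 5] by simp_all
  note small = small_degree_polys[OF X_def[THEN meta_eq_to_obj_eq]]
  have D4: "degree_poly 4 = X + 4 * X ^ 2 + X ^ 3"
    by (simp add: D base)
  consider "n = 0" | "n = 1" | "n = 2" | "n = 3" | "n \<ge> 4" by linarith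
  then show ?thesis
  proof cases
    case 5
    then have "adjusted_poly m = A m + B m + C m" if "m \<ge> n" for m
      using that by (simp add: adjusted_poly_def D)
    then show ?thesis
      using 5 step[of n] step[of "Suc n"] step[of "Suc (Suc n)"]
      by (simp add: eval_nat_numeral algebra_simps)
  next
    case 1
    then show ?thesis
      using small by (simp add: adjusted_poly_def X_def[symmetric] algebra_simps power2_eq_square)
  next
    case 2
    then show ?thesis
      using small D4
      by (simp add: adjusted_poly_def X_def[symmetric] algebra_simps eval_nat_numeral)
  next
    case 3
    then show ?thesis
      using small D4 five base
      by (simp add: adjusted_poly_def X_def[symmetric] D algebra_simps eval_nat_numeral)
  next
    case 4
    then show ?thesis
      using small D4 five six base
      by (simp add: adjusted_poly_def X_def[symmetric] D algebra_simps eval_nat_numeral)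
  qed
qed

text \<open>The denominator expands to \<open>1 - c y - c y^2 - (c - c^2) y^3\<close>. Multiplying
  by it kills all coefficients from index 3 on by the recurrence, and the initial values leave
  \<open>1\<close>, \<open>1\<close> and \<open>- c^2\<close>. The constant term 1 makes the
  denominator nonzero, so division is legitimate.\<close>

lemma Abs_fps_eq_quotient:
  fixes f :: "nat \<Rightarrow> 'a :: field" and c :: 'a
  assumes "f 0 = 1" "f 1 = 1 + c" "f 2 = 2 * c"
    and rec: "\<And>n. f (n + 3) = c * f (n + 2) + c * f (n + 1) + (c - c ^ 2) * f n"
  defines "x \<equiv> fps_const c" and "y \<equiv> fps_X"
  shows "Abs_fps f = (1 + y - x ^ 2 * y ^ 2) / ((1 - x * y) * (1 - x * y ^ 2) - x * y ^ 3)"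
    (is "_ = ?N / ?Q")
proof -
  have "Abs_fps f * ?Q = Abs_fps f - fps_const c * (fps_X ^ 1 * Abs_fps f) -
      fps_const c * (fps_X ^ 2 * Abs_fps f) - fps_const (c - c ^ 2) * (fps_X ^ 3 * Abs_fps f)"
    unfolding x_def y_def fps_const_sub[symmetric] fps_const_power[symmetric] power_one_right
      power2_eq_square power3_eq_cube
    by (simp only: algebra_simps mult_1_left fps_const_mult[symmetric])
  also have "\<dots> = ?N"
  proof (rule fps_ext)
    fix n :: nat
    consider "n = 0" | "n = 1" | "n = 2" | m where "n = m + 3"
    proof -
      have "n = 0 \<or> n = 1 \<or> n = 2 \<or> n = (n - 3) + 3" by linarith
      then show thesis using that by blast
    qed
    then show "(Abs_fps f - fps_const c * (fps_X ^ 1 * Abs_fps f) -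
      fps_const c * (fps_X ^ 2 * Abs_fps f) - fps_const (c - c ^ 2) * (fps_X ^ 3 * Abs_fps f)) $ n =
      ?N $ n"
      using assms(1-3) rec
      by cases (simp_all only: fps_sub_nth fps_add_nth fps_mult_left_const_nth fps_X_power_mult_nth
        x_def y_def fps_const_power fps_X_power_nth fps_X_nth fps_one_nth fps_nth_Abs_fps,
        simp_all add: algebra_simps power2_eq_square)
  qed
  finally have *: "Abs_fps f * ?Q = ?N" .
  have "?Q $ 0 = 1" by (simp add: x_def y_def)
  then have "?Q \<noteq> 0" by (metis fps_zero_nth zero_neq_one)
  then show ?thesis by (simp flip: *)
qed

theorem theorem6:
  defines "x \<equiv> fps_const (to_fract [:0, 1:]) :: int poly fract fps"
    and "y \<equiv> fps_X :: int poly fract fps"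
  shows "Abs_fps (\<lambda>n. to_fract (degree_poly n)) =
    - y + x * y + x ^ 2 * y ^ 2 +
    (1 + y - x ^ 2 * y ^ 2) / ((1 - x * y) * (1 - x * y ^ 2) - x * y ^ 3)"
proof -
  define X where "X = [:0, 1 :: int:]"
  note small = small_degree_polys[OF X_def]
  have adjusted: "adjusted_poly 0 = 1" "adjusted_poly 1 = 1 + X" "adjusted_poly 2 = 2 * X"
    using small by (simp_all add: adjusted_poly_def X_def[symmetric])
  have "Abs_fps (\<lambda>n. to_fract (adjusted_poly n)) =
      (1 + y - x ^ 2 * y ^ 2) / ((1 - x * y) * (1 - x * y ^ 2) - x * y ^ 3)"
    unfolding x_def y_def X_def[symmetric]
  proof (rule Abs_fps_eq_quotient)
    show "to_fract (adjusted_poly (n + 3)) =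
      to_fract X * to_fract (adjusted_poly (n + 2)) + to_fract X * to_fract (adjusted_poly (n + 1)) +
      (to_fract X - to_fract X ^ 2) * to_fract (adjusted_poly n)" for n
      unfolding adjusted_poly_rec X_def[symmetric] to_fract_add to_fract_mult to_fract_diff
        power2_eq_square ..
  qed (simp_all only: adjusted mult_2 to_fract_add to_fract_1)
  \<comment> \<open>The correction terms are the differences to the adjusted values:
    \<open>2 X - (1 + X) = X - 1\<close> at index 1 and \<open>(2 X + X^2) - 2 X = X^2\<close> at
    index 2.\<close>
  moreover have "Abs_fps (\<lambda>n. to_fract (degree_poly n)) =
      - y + x * y + x ^ 2 * y ^ 2 + Abs_fps (\<lambda>n. to_fract (adjusted_poly n))"
    unfolding x_def y_def X_def[symmetric]
  proof (rule fps_ext)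
    fix n :: nat
    consider "n = 0" | "n = 1" | "n = 2" | "n \<ge> 3" by linarith
    then show "Abs_fps (\<lambda>n. to_fract (degree_poly n)) $ n =
      (- fps_X + fps_const (to_fract X) * fps_X + fps_const (to_fract X) ^ 2 * fps_X ^ 2 +
        Abs_fps (\<lambda>n. to_fract (adjusted_poly n))) $ n"
    proof cases
      case 1
      then show ?thesis by (simp add: small adjusted)
    next
      case 2
      have "to_fract (2 * X) = to_fract X + to_fract X"
        by (simp only: mult_2 to_fract_add)
      with 2 show ?thesis
        by (simp add: small[simplified] adjusted[simplified] fps_X_power_nth del: to_fract_mult)
    next
      case 3
      then show ?thesis
        by (simp add: small adjusted fps_X_power_nth power2_eq_square)
    next
      case 4
      then show ?thesis by (simp add: adjusted_poly_def fps_X_power_nth power2_eq_square)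
    qed
  qed
  ultimately show ?thesis by simp
qed

end
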